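(* Let $0<t<1$ and let $b_i=c_i>0$ for all $i\ge1$. Let $\{h(\tau,y)\}_{\tau\in\mathbb R_{\ge0},\,y\in\mathbb Z_{\ge1}}$ be the height function of the half-continuous stochastic six vertex model with parameters $t$, $\{b_y\}_{y\ge1}$, and let $l(\tau,y)$ be the length of the first column (number of nonzero rows) of $\lambda^{(y)}(\tau)$, where $\{\lambda^{(m)}(\tau)\}$ is the Hall--Littlewood RSK dynamics with parameters $t$, $\{c_i\}_{i\ge1}$. Then the random fields $$\{h(\tau,y)\}_{\tau\in\mathbb R_{\ge0},\,y\in\mathbb Z_{\ge1}}\qquad\text{and}\qquad\{\,y-l(\tau,y)\,\}_{\tau\in\mathbb R_{\ge0},\,y\in\mathbb Z_{\ge1}}$$ are identically distributed.
   Context: **Half-continuous stochastic six vertex model.** This is the limit $\varepsilon\to0$ of the stochastic six vertex model in the quadrant with all column parameters $a_x=\varepsilon/(1-t)$ and horizontal coordinate in $\varepsilon\mathbb Z_{\ge1}$, whose weights at a vertex with row parameter $b_y$ are: nothing in, nothing out: $1$; both incoming edges (left, bottom) occupied, both outgoing edges (right, top) occupied: $1$; left in, right out: $\frac{1-a_xb_y}{1-ta_xb_y}$; left in, top out: $\frac{(1-t)a_xb_y}{1-ta_xb_y}$; bottom in, top out: $\frac{t(1-a_xb_y)}{1-ta_xb_y}$; bottom in, right out: $\frac{1-t}{1-ta_xb_y}$; with left boundary edges all occupied and bottom boundary edges all empty. Explicitly, the limit is the following model of up-right paths in $\mathbb R_{\ge0}\times\mathbb Z_{\ge1}$: at horizontal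 coordinate $0$ each row $y\ge1$ is occupied by a path travelling horizontally to the right. Independently over $y$, there are Poisson processes on $\mathbb R_{\ge0}$ of intensities $b_y$; at a point $\tau$ of the process of row $y$, if row $y$ is occupied just before $\tau$, the path in row $y$ turns up at $\tau$, row $y$ becoming empty (if row $y$ is empty, nothing happens). The upward-going path then visits rows $y+1,y+2,\dots$ successively at the same coordinate $\tau$: in an occupied row $y'$, one path continues up and row $y'$ remains occupied to the right; in an empty row $y'$, independently, with probability $1-t$ the path turns right (row $y'$ becomes occupied and the upward motion ends) and with probability $t$ it continues up. The height function $h(\tau,y)$ is the number of paths through or to the right of $(\tau,y)$, i.e. the number of rows $y'\in\{1,\dots,y\}$ occupied at horizontal coordinate $\tau$. (The values at the random jump points themselves are immaterial: equality in distribution is for finite-dimensional distributions, and a fixed $\tau$ is a.s. not a jump point.) **Hall--Littlewood RSK dynamics.** Let $c_1,c_2,\dots>0$ and let $\mathcal P_1,\mathcal P_2,\dots$ be independent Poisson processes on $\mathbb R_{\ge0}$, $\mathcal P_i$ having intensity $c_i$. The state at time $\tau$ is a sequence of partitions $\lambda^{(1)}(\tau)\subset\lambda^{(2)}(\tau)\subset\cdots$, where $\lambda^{(k)}=(\lambda^{(k)}_1\ge\dots\ge\lambda^{(k)}_k\ge0)$ has exactly $k$ rows (zero rows allowed) and $\lambda^{(m+1)}_{i+1}\le\lambda^{(m)}_i\le\lambda^{(m+1)}_i$ for $i\le m$. (The first $n$ partitions evolve autonomously for every $n$, so the infinite dynamics is well defined.) A row $\lambda_i^{(m)}$ with $i\ge2$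 is blocked if $\lambda_i^{(m)}=\lambda_{i-1}^{(m-1)}$; all other rows are free. The nearest neighbor of $\lambda_i^{(m)}$ is the free row $\lambda_j^{(m+1)}$ with $j\le i$ and $j$ as large as possible. Initially all rows are $0$. At a time $\tau\in\mathcal P_k$ the following happens (all equalities and notions refer to the array just before $\tau$): 1) $\lambda^{(1)},\dots,\lambda^{(k-1)}$ do not change; in each of $\lambda^{(k)},\lambda^{(k+1)},\dots$ exactly one row increases by $1$. 2) In $\lambda^{(k)}$ the smallest free row (the one with the largest index) increases by $1$. 3) For $m=k,k+1,\dots$ successively, if the row $\lambda_i^{(m)}$ has increased: (3a) if $\lambda_i^{(m)}=\lambda_i^{(m+1)}$ before the change, then $\lambda_i^{(m+1)}$ increases by $1$; (3b) otherwise, independently at random, either the nearest neighbor of $\lambda_i^{(m)}$ increases by $1$ (probability $R$) or $\lambda_{i+1}^{(m+1)}$ increases by $1$ (probability $L=1-R$). 4) Let $D$ be the number of rows of $\lambda^{(m)}$ other than $\lambda_i^{(m)}$ with the same length as $\lambda_i^{(m)}$ before the change; in case (3b) the number of rows of $\lambda^{(m+1)}$ of this length is $D$ or $D+1$. If it is $D+1$, then $R=1-t$; if it is $D$, then $R=\frac{1-t}{1-t^{D+1}}$. *)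

theory Defs
  imports "HOL-Probability.Probability"
begin

text \<open>
  The Poisson process of row \<open>k \<ge> 1\<close> is given by its points
  \<open>T k 0 < T k 1 < \<dots>\<close>: the first point and the successive spacings are independent and identically
  exponentially distributed. Every random choice made at the \<open>j\<close>-th point of the process of row \<open>k\<close>
  uses a fresh uniform variable: \<open>U k j m\<close> decides what happens on row (or level) \<open>m\<close>,
  and an alternative of probability \<open>p\<close> is chosen iff \<open>U k j m < p\<close>.
\<close>

definition spacing :: "(nat \<Rightarrow> nat \<Rightarrow> 'w \<Rightarrow> real) \<Rightarrow> nat \<Rightarrow> nat \<Rightarrow> 'w \<Rightarrow> real" where
  "spacing T k j \<omega> = (case j of 0 \<Rightarrow> T k 0 \<omega> | Suc i \<Rightarrow> T k (Suc i) \<omega> - T k i \<omega>)"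

definition driving_noise ::
  "'w measure \<Rightarrow> (nat \<Rightarrow> real) \<Rightarrow> (nat \<Rightarrow> nat \<Rightarrow> 'w \<Rightarrow> real) \<Rightarrow>
    (nat \<Rightarrow> nat \<Rightarrow> nat \<Rightarrow> 'w \<Rightarrow> real) \<Rightarrow> bool" where
  "driving_noise M c T U \<longleftrightarrow>
     prob_space M \<and>
     (\<forall>k\<ge>1. \<forall>j. distributed M lborel (spacing T k j) (exponential_density (c k))) \<and>
     (\<forall>k\<ge>1. \<forall>j m. distr M lborel (U k j m) = uniform_measure lborel {0..1}) \<and>
     prob_space.indep_vars M (\<lambda>_. borel)
       (case_sum (\<lambda>(k, j). spacing T k j) (\<lambda>(k, j, m). U k j m))
       (({1..} \<times> UNIV) <+> ({1..} \<times> UNIV \<times> UNIV))"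

text \<open>
  The points of the processes of rows \<open>1, \<dots>, n\<close> in \<open>[0, \<tau>]\<close>, in the order in which
  they occur; the entry \<open>(k, j)\<close> stands for the \<open>j\<close>-th point of row \<open>k\<close>. Coinciding points,
  or infinitely many points in \<open>[0, \<tau>]\<close>, occur with probability \<open>0\<close>.
\<close>

definition points_upto :: "(nat \<Rightarrow> nat \<Rightarrow> 'w \<Rightarrow> real) \<Rightarrow> nat \<Rightarrow> real \<Rightarrow> 'w \<Rightarrow> (nat \<times> nat) list" where
  "points_upto T n \<tau> \<omega> =
     sort_key (\<lambda>(k, j). T k j \<omega>)
       (concat (map (\<lambda>k. map (Pair k) [0..<card {j. T k j \<omega> \<le> \<tau>}]) [1..<Suc n]))"


text \<open>
  \<open>S y\<close> says that row \<open>y\<close> is occupied. \<open>path_leaves_up t u S k d\<close> says that, at a point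
  of the process of row \<open>k\<close>, an upward-going path leaves row \<open>k + d\<close> through its top;
  \<open>u y\<close> is the uniform variable used on row \<open>y\<close>.
\<close>

primrec path_leaves_up :: "real \<Rightarrow> (nat \<Rightarrow> real) \<Rightarrow> (nat \<Rightarrow> bool) \<Rightarrow> nat \<Rightarrow> nat \<Rightarrow> bool" where
  "path_leaves_up t u S k 0 \<longleftrightarrow> S k"
| "path_leaves_up t u S k (Suc d) \<longleftrightarrow>
     path_leaves_up t u S k d \<and> (S (k + Suc d) \<or> \<not> u (k + Suc d) < 1 - t)"

definition sixv_step :: "real \<Rightarrow> (nat \<Rightarrow> real) \<Rightarrow> nat \<Rightarrow> (nat \<Rightarrow> bool) \<Rightarrow> nat \<Rightarrow> bool" where
  "sixv_step t u k S y \<longleftrightarrow>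
     (if y < k then S y
      else if y = k then False
      else S y \<or> (path_leaves_up t u S k (y - Suc k) \<and> u y < 1 - t))"

text \<open>
  Row \<open>y\<close> is only affected by the points of rows \<open>\<le> y\<close>, and rows \<open>1, \<dots>, n\<close>
  evolve autonomously; so their occupation is computed from the finitely many points of the
  first \<open>n\<close> processes.
\<close>

definition sixv_occupied ::
  "real \<Rightarrow> (nat \<Rightarrow> nat \<Rightarrow> 'w \<Rightarrow> real) \<Rightarrow> (nat \<Rightarrow> nat \<Rightarrow> nat \<Rightarrow> 'w \<Rightarrow> real) \<Rightarrow>
    nat \<Rightarrow> real \<Rightarrow> 'w \<Rightarrow> nat \<Rightarrow> bool" where
  "sixv_occupied t T U n \<tau> \<omega> =
     fold (\<lambda>(k, j). sixv_step t (\<lambda>m. U k j m \<omega>) k) (points_upto T n \<tau> \<omega>) (\<lambda>_. True)"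

definition sixv_height ::
  "real \<Rightarrow> (nat \<Rightarrow> nat \<Rightarrow> 'w \<Rightarrow> real) \<Rightarrow> (nat \<Rightarrow> nat \<Rightarrow> nat \<Rightarrow> 'w \<Rightarrow> real) \<Rightarrow>
    real \<Rightarrow> nat \<Rightarrow> 'w \<Rightarrow> nat" where
  "sixv_height t T U \<tau> y \<omega> = card {y' \<in> {1..y}. sixv_occupied t T U y \<tau> \<omega> y'}"


text \<open>
  An array \<open>\<Lambda>\<close> has entries \<open>\<Lambda> m i\<close>, the length of row \<open>i\<close> of the partition on level
  \<open>m\<close>, for \<open>1 \<le> i \<le> m\<close>. In the definitions below \<open>\<Lambda>\<close> is the array just before the
  jump time.
\<close>

type_synonym part_array = "nat \<Rightarrow> nat \<Rightarrow> nat"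

definition blocked :: "part_array \<Rightarrow> nat \<Rightarrow> nat \<Rightarrow> bool" where
  "blocked \<Lambda> m i \<longleftrightarrow> i \<ge> 2 \<and> \<Lambda> m i = \<Lambda> (m - 1) (i - 1)"

definition free_rows :: "part_array \<Rightarrow> nat \<Rightarrow> nat set" where
  "free_rows \<Lambda> m = {i \<in> {1..m}. \<not> blocked \<Lambda> m i}"

definition nearest_neighbor :: "part_array \<Rightarrow> nat \<Rightarrow> nat \<Rightarrow> nat" where
  "nearest_neighbor \<Lambda> m i = Max {j \<in> free_rows \<Lambda> (Suc m). j \<le> i}"

definition R_prob :: "real \<Rightarrow> part_array \<Rightarrow> nat \<Rightarrow> nat \<Rightarrow> real" where
  "R_prob t \<Lambda> m i =
     (let D = card {j \<in> {1..m}. j \<noteq> i \<and> \<Lambda> m j = \<Lambda> m i}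
      in if card {j \<in> {1..Suc m}. \<Lambda> (Suc m) j = \<Lambda> m i} = D + 1
         then 1 - t else (1 - t) / (1 - t ^ (D + 1)))"

definition next_row :: "real \<Rightarrow> (nat \<Rightarrow> real) \<Rightarrow> part_array \<Rightarrow> nat \<Rightarrow> nat \<Rightarrow> nat" where
  "next_row t u \<Lambda> m i =
     (if \<Lambda> m i = \<Lambda> (Suc m) i then i
      else if u (Suc m) < R_prob t \<Lambda> m i then nearest_neighbor \<Lambda> m i
      else Suc i)"

text \<open>
  \<open>moved_row t u \<Lambda> k d\<close> is the row of level \<open>k + d\<close> that increases at a point of the
  process of level \<open>k\<close>.
\<close>

primrec moved_row :: "real \<Rightarrow> (nat \<Rightarrow> real) \<Rightarrow> part_array \<Rightarrow> nat \<Rightarrow> nat \<Rightarrow> nat" where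
  "moved_row t u \<Lambda> k 0 = Max (free_rows \<Lambda> k)"
| "moved_row t u \<Lambda> k (Suc d) = next_row t u \<Lambda> (k + d) (moved_row t u \<Lambda> k d)"

definition rsk_step :: "real \<Rightarrow> (nat \<Rightarrow> real) \<Rightarrow> nat \<Rightarrow> part_array \<Rightarrow> part_array" where
  "rsk_step t u k \<Lambda> m i =
     (if k \<le> m \<and> i = moved_row t u \<Lambda> k (m - k) then Suc (\<Lambda> m i) else \<Lambda> m i)"

text \<open>
  As above, levels \<open>1, \<dots>, n\<close> evolve autonomously and are computed from the points of
  the first \<open>n\<close> processes; \<open>rsk_array t T U n \<tau> \<omega> m\<close> is \<open>\<lambda>\<^sup>(\<^sup>m\<^sup>)(\<tau>)\<close> for \<open>m \<le> n\<close>.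
\<close>

definition rsk_array ::
  "real \<Rightarrow> (nat \<Rightarrow> nat \<Rightarrow> 'w \<Rightarrow> real) \<Rightarrow> (nat \<Rightarrow> nat \<Rightarrow> nat \<Rightarrow> 'w \<Rightarrow> real) \<Rightarrow>
    nat \<Rightarrow> real \<Rightarrow> 'w \<Rightarrow> part_array" where
  "rsk_array t T U n \<tau> \<omega> =
     fold (\<lambda>(k, j). rsk_step t (\<lambda>m. U k j m \<omega>) k) (points_upto T n \<tau> \<omega>) (\<lambda>_ _. 0)"

definition rsk_first_column ::
  "real \<Rightarrow> (nat \<Rightarrow> nat \<Rightarrow> 'w \<Rightarrow> real) \<Rightarrow> (nat \<Rightarrow> nat \<Rightarrow> nat \<Rightarrow> 'w \<Rightarrow> real) \<Rightarrow>
    real \<Rightarrow> nat \<Rightarrow> 'w \<Rightarrow> nat" where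
  "rsk_first_column t T U \<tau> y \<omega> = card {i \<in> {1..y}. rsk_array t T U y \<tau> \<omega> y i \<noteq> 0}"


definition identically_distributed_fields ::
  "'p set \<Rightarrow> 'v measure \<Rightarrow> ('p \<Rightarrow> 'v \<Rightarrow> int) \<Rightarrow> 'w measure \<Rightarrow> ('p \<Rightarrow> 'w \<Rightarrow> int) \<Rightarrow> bool" where
  "identically_distributed_fields I M X N Y \<longleftrightarrow>
     (\<forall>p\<in>I. X p \<in> M \<rightarrow>\<^sub>M count_space UNIV) \<and>
     (\<forall>p\<in>I. Y p \<in> N \<rightarrow>\<^sub>M count_space UNIV) \<and>
     (\<forall>J. finite J \<and> J \<subseteq> I \<longrightarrow>
        distr M (\<Pi>\<^sub>M p\<in>J. count_space UNIV) (\<lambda>\<omega>. \<lambda>p\<in>J. X p \<omega>) =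
        distr N (\<Pi>\<^sub>M p\<in>J. count_space UNIV) (\<lambda>\<omega>. \<lambda>p\<in>J. Y p \<omega>))"

end

theory Submission
  imports Defs
begin

text \<open>
  Driven by the same noise, the two models agree pathwise (almost surely): row \<open>y\<close> is occupied
  iff \<open>\<lambda>\<^sup>(\<^sup>y\<^sup>)\<close> and \<open>\<lambda>\<^sup>(\<^sup>y\<^sup>-\<^sup>1\<^sup>)\<close> have first columns of the same length, and the upward path leaves
  row \<open>y\<close> through its top iff the row of \<open>\<lambda>\<^sup>(\<^sup>y\<^sup>)\<close> that increases was empty. If that row was empty
  and row \<open>y + 1\<close> is vacant, then \<open>R = 1 - t\<close>, the probability of turning right. If it was
  nonempty, an empty row of level \<open>y + 1\<close> could increase only by the alternative \<open>L\<close> with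
  \<open>D = 0\<close> and \<open>R = 1\<close>, hence with probability \<open>0\<close>. It remains to note that the law of the vertex
  model is a function of the law of its noise.
\<close>

section \<open>Interlacing arrays and the length of the first column\<close>

definition interlacing :: "part_array \<Rightarrow> bool" where
  "interlacing \<Lambda> \<longleftrightarrow>
     (\<forall>m\<ge>1. \<forall>i\<in>{1..m}. \<Lambda> (Suc m) (Suc i) \<le> \<Lambda> m i \<and> \<Lambda> m i \<le> \<Lambda> (Suc m) i)"

definition column_length :: "part_array \<Rightarrow> nat \<Rightarrow> nat" where
  "column_length \<Lambda> m = card {i \<in> {1..m}. \<Lambda> m i \<noteq> 0}"

text \<open>Row \<open>i\<close> of level \<open>m\<close> can increase without destroying the monotonicity of the partition.\<close>

definition movable :: "part_array \<Rightarrow> nat \<Rightarrow> nat \<Rightarrow> bool" where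
  "movable \<Lambda> m i \<longleftrightarrow> i \<in> {1..m} \<and> (i = 1 \<or> \<Lambda> m i < \<Lambda> m (i - 1))"

lemma interlacingD:
  assumes "interlacing \<Lambda>" "1 \<le> i" "i \<le> m"
  shows "\<Lambda> (Suc m) (Suc i) \<le> \<Lambda> m i" "\<Lambda> m i \<le> \<Lambda> (Suc m) i"
  using assms unfolding interlacing_def by auto

text \<open>Rows \<open>j\<close> and \<open>Suc j\<close> of level \<open>m\<close> are separated
  by row \<open>j\<close> of level \<open>m - 1\<close>.\<close>

lemma interlacing_antimono:
  assumes "interlacing \<Lambda>" "1 \<le> i" "i \<le> j" "j \<le> m"
  shows "\<Lambda> m j \<le> \<Lambda> m i"
  using assms(3,4)
proof (induction j rule: dec_induct)
  case (step j)
  then obtain m' where m': "m = Suc m'" "j \<le> m'"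
    by (cases m) auto
  have "\<Lambda> m (Suc j) \<le> \<Lambda> m j"
    using interlacingD[OF assms(1), of j m'] m' step assms(2) by force
  with step show ?case by simp
qed simp

lemma down_closed_eq_atLeastAtMost_card:
  fixes A :: "nat set"
  assumes "finite A" "0 \<notin> A" "\<And>i j. j \<in> A \<Longrightarrow> 1 \<le> i \<Longrightarrow> i \<le> j \<Longrightarrow> i \<in> A"
  shows "A = {1..card A}"
proof (cases "A = {}")
  case False
  define M where "M = Max A"
  have M: "M \<in> A" "\<And>i. i \<in> A \<Longrightarrow> i \<le> M"
    using False assms(1) by (auto simp: M_def)
  have "A = {1..M}"
  proof (intro set_eqI iffI)
    fix i assume "i \<in> A"
    moreover from this assms(2) have "i \<noteq> 0" by metis
    ultimately show "i \<in> {1..M}" using M(2) by simp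
  next
    fix i assume "i \<in> {1..M}"
    then show "i \<in> A" using assms(3)[OF M(1)] by simp
  qed
  then show ?thesis by (simp only: card_atLeastAtMost diff_Suc_1)
qed simp

text \<open>Rows weakly decrease along a level, so the nonzero ones form an initial segment. This
  turns every later question about empty rows into a comparison of a row index with
  \<open>column_length\<close>.\<close>

lemma nonzero_rows_eq:
  assumes "interlacing \<Lambda>"
  shows "{i \<in> {1..m}. \<Lambda> m i \<noteq> 0} = {1..column_length \<Lambda> m}"
  unfolding column_length_def
proof (rule down_closed_eq_atLeastAtMost_card)
  fix i j assume j: "j \<in> {i \<in> {1..m}. \<Lambda> m i \<noteq> 0}" "1 \<le> i" "i \<le> j"
  then have "\<Lambda> m j \<le> \<Lambda> m i"
    by (intro interlacing_antimono[OF assms]) auto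
  with j show "i \<in> {i \<in> {1..m}. \<Lambda> m i \<noteq> 0}" by auto
qed auto

lemma zero_iff_column_length:
  assumes "interlacing \<Lambda>" "1 \<le> i" "i \<le> m"
  shows "\<Lambda> m i = 0 \<longleftrightarrow> column_length \<Lambda> m < i"
proof -
  have "i \<in> {i \<in> {1..m}. \<Lambda> m i \<noteq> 0} \<longleftrightarrow> i \<in> {1..column_length \<Lambda> m}"
    by (simp only: nonzero_rows_eq[OF assms(1)])
  with assms(2,3) show ?thesis by auto
qed

lemma column_length_le: "column_length \<Lambda> m \<le> m"
  unfolding column_length_def
  by (rule order.trans[OF card_mono[of "{1..m}"]]) auto

lemma card_zero_rows:
  "card {i \<in> {1..m}. \<Lambda> m i = 0} = m - column_length \<Lambda> m"
proof -
  have "{i \<in> {1..m}. \<Lambda> m i = 0} = {1..m} - {i \<in> {1..m}. \<Lambda> m i \<noteq> 0}"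
    by auto
  then have "card {i \<in> {1..m}. \<Lambda> m i = 0} = card {1..m} - card {i \<in> {1..m}. \<Lambda> m i \<noteq> 0}"
    by (metis (no_types, lifting) card_Diff_subset finite_atLeastAtMost finite_subset
        mem_Collect_eq subsetI)
  then show ?thesis
    unfolding column_length_def by simp
qed

lemma column_length_0 [simp]: "column_length \<Lambda> 0 = 0"
  by (simp add: column_length_def)

text \<open>Row \<open>i\<close> of level \<open>m\<close> lies between rows \<open>i + 1\<close>
  and \<open>i\<close> of level \<open>m + 1\<close>: the upper bound keeps nonzero rows nonzero,
  the lower bound forbids two additional ones.\<close>

lemma column_length_Suc:
  assumes "interlacing \<Lambda>"
  shows "column_length \<Lambda> m \<le> column_length \<Lambda> (Suc m)"
    and "column_length \<Lambda> (Suc m) \<le> Suc (column_length \<Lambda> m)"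
proof -
  let ?l = "column_length \<Lambda>"
  show "?l m \<le> ?l (Suc m)"
  proof (cases "?l m = 0")
    case False
    then show ?thesis
      using zero_iff_column_length[OF assms, of "?l m" m] interlacingD(2)[OF assms, of "?l m" m]
        zero_iff_column_length[OF assms, of "?l m" "Suc m"] column_length_le[of \<Lambda> m]
      by force
  qed simp
  show "?l (Suc m) \<le> Suc (?l m)"
  proof (rule ccontr)
    assume *: "\<not> ?thesis"
    define i where "i = ?l (Suc m) - 1"
    have i: "1 \<le> i" "i \<le> m" "?l m < i" "Suc i = ?l (Suc m)"
      using * column_length_le[of \<Lambda> "Suc m"] by (auto simp: i_def)
    then have "\<Lambda> m i = 0" "\<Lambda> (Suc m) (Suc i) \<noteq> 0"
      using zero_iff_column_length[OF assms, of i m]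
        zero_iff_column_length[OF assms, of "Suc i" "Suc m"] by auto
    with interlacingD(1)[OF assms i(1,2)] show False by simp
  qed
qed

section \<open>Free rows, movable rows and preservation of interlacing\<close>

lemma finite_free_rows [simp]: "finite (free_rows \<Lambda> m)"
  by (simp add: free_rows_def)

lemma one_in_free_rows: "1 \<le> m \<Longrightarrow> 1 \<in> free_rows \<Lambda> m"
  by (simp add: free_rows_def blocked_def)

text \<open>Row 1 is never blocked, so the maximum is taken over a nonempty set.\<close>

lemma nearest_neighbor_free:
  assumes "1 \<le> i"
  shows "nearest_neighbor \<Lambda> m i \<in> free_rows \<Lambda> (Suc m)" "nearest_neighbor \<Lambda> m i \<le> i"
proof -
  have "nearest_neighbor \<Lambda> m i \<in> {j \<in> free_rows \<Lambda> (Suc m). j \<le> i}"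
    unfolding nearest_neighbor_def
    using assms one_in_free_rows[of "Suc m" \<Lambda>] by (intro Max_in) auto
  then show "nearest_neighbor \<Lambda> m i \<in> free_rows \<Lambda> (Suc m)" "nearest_neighbor \<Lambda> m i \<le> i"
    by auto
qed

lemma free_row_below:
  assumes "interlacing \<Lambda>" "i \<in> free_rows \<Lambda> (Suc m)" "i \<noteq> 1"
  shows "\<Lambda> (Suc m) i < \<Lambda> m (i - 1)"
proof -
  have "2 \<le> i" "i \<le> Suc m" "\<Lambda> (Suc m) i \<noteq> \<Lambda> m (i - 1)"
    using assms(2,3) by (auto simp: free_rows_def blocked_def)
  then show ?thesis
    using interlacingD(1)[OF assms(1), of "i - 1" m] by force
qed

lemma free_row_movable:
  assumes "interlacing \<Lambda>" "i \<in> free_rows \<Lambda> (Suc m)"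
  shows "movable \<Lambda> (Suc m) i"
proof (cases "i = 1")
  case False
  moreover have "i \<in> {1..Suc m}"
    using assms(2) by (simp add: free_rows_def)
  ultimately show ?thesis
    using free_row_below[OF assms False] interlacingD(2)[OF assms(1), of "i - 1" m]
    by (force simp: movable_def)
qed (use assms in \<open>auto simp: movable_def\<close>)

text \<open>In case (3a) row \<open>i\<close> of level \<open>m + 1\<close> equals the movable row
  \<open>i\<close> of level \<open>m\<close>, hence is strictly shorter than row
  \<open>i - 1\<close> of level \<open>m\<close> and is free. R selects a free row by definition.
  Only L can hit a blocked row, and then the row blocking it is row \<open>i\<close> of level
  \<open>m\<close>, which grows as well.\<close>

lemma next_row_free_or_Suc:
  assumes "interlacing \<Lambda>" "movable \<Lambda> m i"
  shows "next_row t u \<Lambda> m i \<in> free_rows \<Lambda> (Suc m) \<or>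
    next_row t u \<Lambda> m i = Suc i \<and> \<Lambda> m i < \<Lambda> (Suc m) i"
proof (cases "\<Lambda> m i = \<Lambda> (Suc m) i")
  case True
  then show ?thesis
    using assms by (auto simp: movable_def next_row_def free_rows_def blocked_def)
next
  case False
  have "1 \<le> i" "i \<le> m"
    using assms(2) by (auto simp: movable_def)
  with False show ?thesis
    using nearest_neighbor_free(1)[of i \<Lambda> m] interlacingD(2)[OF assms(1), of i m]
    by (auto simp: next_row_def)
qed

lemma movable_next_row:
  assumes "interlacing \<Lambda>" "movable \<Lambda> m i"
  shows "movable \<Lambda> (Suc m) (next_row t u \<Lambda> m i)"
proof -
  have *: "1 \<le> i" "i \<le> m"
    using assms(2) by (auto simp: movable_def)
  show ?thesis
    using next_row_free_or_Suc[OF assms, of t u]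
  proof
    assume "next_row t u \<Lambda> m i = Suc i \<and> \<Lambda> m i < \<Lambda> (Suc m) i"
    with * interlacingD(1)[OF assms(1) *] show ?thesis
      by (auto simp: movable_def)
  qed (rule free_row_movable[OF assms(1)])
qed

lemma moved_row_0_free: "1 \<le> k \<Longrightarrow> moved_row t u \<Lambda> k 0 \<in> free_rows \<Lambda> k"
  using one_in_free_rows[of k \<Lambda>] by (auto intro!: Max_in)

lemma movable_moved_row:
  assumes "interlacing \<Lambda>" "1 \<le> k"
  shows "movable \<Lambda> (k + d) (moved_row t u \<Lambda> k d)"
proof (induction d)
  case 0
  obtain k' where "k = Suc k'" using assms(2) by (cases k) auto
  then show ?case
    using free_row_movable[OF assms(1)] moved_row_0_free[OF assms(2)] by auto
next
  case (Suc d)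
  then show ?case
    using movable_next_row[OF assms(1)] by simp
qed

text \<open>Every row grows by at most 1, so an inequality can break only if its smaller side grows
  alone; strictness beforehand has to be shown exactly then.\<close>

lemma interlacing_rsk_step:
  assumes "interlacing \<Lambda>" "1 \<le> k"
  shows "interlacing (rsk_step t u k \<Lambda>)"
  unfolding interlacing_def
proof (intro allI impI ballI)
  fix m i :: nat
  assume m: "1 \<le> m" and i: "i \<in> {1..m}"
  let ?\<Lambda> = "rsk_step t u k \<Lambda>" and ?r = "\<lambda>m. moved_row t u \<Lambda> k (m - k)"
  have old: "\<Lambda> (Suc m) (Suc i) \<le> \<Lambda> m i" "\<Lambda> m i \<le> \<Lambda> (Suc m) i"
    using interlacingD[OF assms(1), of i m] i by auto
  consider "Suc m < k" | "Suc m = k" | "k \<le> m" by linarith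
  then show "?\<Lambda> (Suc m) (Suc i) \<le> ?\<Lambda> m i \<and> ?\<Lambda> m i \<le> ?\<Lambda> (Suc m) i"
  proof cases
    case 1
    with old show ?thesis by (simp add: rsk_step_def)
  next
    case 2
    \<comment> \<open>Level \<open>m\<close> does not change, but the row that grows on level
      \<open>k\<close> is free, which gives the strict inequality.\<close>
    have "\<Lambda> (Suc m) (Suc i) < \<Lambda> m i" if "Suc i = ?r k"
      using free_row_below[OF assms(1), of "?r k" m] moved_row_0_free[OF assms(2), of t u \<Lambda>] 2 that i
      by (metis Suc_eq_plus1 add_cancel_left_left add_diff_cancel_right' atLeastAtMost_iff
          diff_self_eq_0 not_one_le_zero)
    with old 2 show ?thesis by (auto simp: rsk_step_def)
  next
    case 3
    have step: "?r (Suc m) = next_row t u \<Lambda> m (?r m)"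
      using 3 by (simp add: Suc_diff_le)
    have mov: "movable \<Lambda> m (?r m)"
      using movable_moved_row[OF assms, of "m - k" t u] 3 by simp
    \<comment> \<open>Since row \<open>i\<close> of level \<open>m\<close> stays put, row
      \<open>Suc i\<close> is not the L-successor of the moved row, so it is free.\<close>
    have "\<Lambda> (Suc m) (Suc i) < \<Lambda> m i" if "Suc i = ?r (Suc m)" "i \<noteq> ?r m"
    proof -
      have "Suc i \<in> free_rows \<Lambda> (Suc m)"
        using next_row_free_or_Suc[OF assms(1) mov, of t u] that step by (metis nat.inject)
      from free_row_below[OF assms(1) this] i show ?thesis by simp
    qed
    \<comment> \<open>Equality would have triggered case (3a), which moves row \<open>i\<close> on
      both levels.\<close>
    moreover have "\<Lambda> m i < \<Lambda> (Suc m) i" if "i = ?r m" "i \<noteq> ?r (Suc m)"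
    proof -
      have "\<Lambda> m i \<noteq> \<Lambda> (Suc m) i"
        using that step by (metis next_row_def)
      with old show ?thesis by simp
    qed
    ultimately show ?thesis
      using 3 old by (auto simp: rsk_step_def)
  qed
qed

section \<open>One jump of the array against one jump of the vertex model\<close>

lemma column_length_rsk_step:
  assumes "interlacing \<Lambda>" "1 \<le> k"
  shows "column_length (rsk_step t u k \<Lambda>) m =
    column_length \<Lambda> m + of_bool (k \<le> m \<and> \<Lambda> m (moved_row t u \<Lambda> k (m - k)) = 0)"
proof (cases "k \<le> m \<and> \<Lambda> m (moved_row t u \<Lambda> k (m - k)) = 0")
  case True
  let ?r = "moved_row t u \<Lambda> k (m - k)"
  have "?r \<in> {1..m}"
    using movable_moved_row[OF assms, of "m - k" t u] True by (simp add: movable_def)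
  then have "{i \<in> {1..m}. rsk_step t u k \<Lambda> m i \<noteq> 0} = insert ?r {i \<in> {1..m}. \<Lambda> m i \<noteq> 0}"
    using True by (auto simp: rsk_step_def)
  with True show ?thesis
    unfolding column_length_def by simp
next
  case False
  then have "{i \<in> {1..m}. rsk_step t u k \<Lambda> m i \<noteq> 0} = {i \<in> {1..m}. \<Lambda> m i \<noteq> 0}"
    by (auto simp: rsk_step_def)
  with False show ?thesis
    unfolding column_length_def by simp
qed

text \<open>The occupation read off from the array: \<open>column_length\<close> counts the vacant
  rows up to \<open>y\<close>, so a row is vacant where it increases. For \<open>y = 1\<close> the
  comparison is with level 0, whose column length is 0.\<close>

definition occupied_of :: "part_array \<Rightarrow> nat \<Rightarrow> bool" where
  "occupied_of \<Lambda> y \<longleftrightarrow> column_length \<Lambda> y = column_length \<Lambda> (y - 1)"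

lemma column_length_not_occupied:
  assumes "interlacing \<Lambda>" "\<not> occupied_of \<Lambda> (Suc m)"
  shows "column_length \<Lambda> (Suc m) = Suc (column_length \<Lambda> m)"
  using column_length_Suc[OF assms(1), of m] assms(2) by (simp add: occupied_of_def)

text \<open>A free empty row \<open>r\<close> requires row \<open>r - 1\<close> of level
  \<open>k - 1\<close> to be nonempty or \<open>r = 1\<close>, so level \<open>k\<close> has no
  additional nonzero row. Conversely, if the two column lengths agree, the first empty row of level
  \<open>k\<close> is free, and the largest free index is at least as large.\<close>

lemma first_moved_row_zero_iff:
  assumes "interlacing \<Lambda>" "1 \<le> k"
  shows "\<Lambda> k (moved_row t u \<Lambda> k 0) = 0 \<longleftrightarrow> occupied_of \<Lambda> k"
proof -
  obtain k' where k': "k = Suc k'" using assms(2) by (cases k) auto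
  let ?l = "column_length \<Lambda>" and ?r = "moved_row t u \<Lambda> k 0"
  have free: "?r \<in> free_rows \<Lambda> k" by (rule moved_row_0_free[OF assms(2)])
  then have r: "1 \<le> ?r" "?r \<le> k" by (auto simp: free_rows_def)
  note zero = zero_iff_column_length[OF assms(1)]
  show ?thesis
  proof
    assume "\<Lambda> k ?r = 0"
    then have "?l k < ?r" using zero[OF r] by simp
    moreover have "?r - 1 \<le> ?l k'"
    proof (cases "?r = 1")
      case False
      then have "\<Lambda> k' (?r - 1) \<noteq> 0"
        using free_row_below[OF assms(1), of ?r k'] free k' by simp
      then show ?thesis
        using zero[of "?r - 1" k'] False r k' by linarith
    qed simp
    ultimately show "occupied_of \<Lambda> k"
      using column_length_Suc[OF assms(1), of k'] k' by (simp add: occupied_of_def)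
  next
    assume occ: "occupied_of \<Lambda> k"
    then have l: "?l k = ?l k'" by (simp add: occupied_of_def k')
    let ?i = "Suc (?l k)"
    have i: "1 \<le> ?i" "?i \<le> k"
      using column_length_le[of \<Lambda> k'] l k' by auto
    have "?i \<in> free_rows \<Lambda> k"
      using i zero[of ?i k] zero[of "?l k" k'] l k' column_length_le[of \<Lambda> k']
      by (auto simp: free_rows_def blocked_def)
    then have "?i \<le> ?r" by simp
    then show "\<Lambda> k ?r = 0" using zero[OF r] by simp
  qed
qed

lemma next_row_zero_iff:
  assumes "interlacing \<Lambda>" "movable \<Lambda> m i" "u (Suc m) < 1" "t < 1"
  shows "\<Lambda> (Suc m) (next_row t u \<Lambda> m i) = 0 \<longleftrightarrow>
    \<Lambda> m i = 0 \<and> (occupied_of \<Lambda> (Suc m) \<or> \<not> u (Suc m) < 1 - t)"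
proof -
  let ?l = "column_length \<Lambda>"
  have i: "1 \<le> i" "i \<le> m" and below: "i = 1 \<or> \<Lambda> m i < \<Lambda> m (i - 1)"
    using assms(2) by (auto simp: movable_def)
  note zero = zero_iff_column_length[OF assms(1)]
  note mono = interlacing_antimono[OF assms(1)]
  have nn: "1 \<le> nearest_neighbor \<Lambda> m i" "nearest_neighbor \<Lambda> m i \<le> i"
    using nearest_neighbor_free[OF i(1), of \<Lambda> m] by (auto simp: free_rows_def)
  show ?thesis
  proof (cases "\<Lambda> m i = 0")
    case True
    \<comment> \<open>A movable empty row is the first empty row of its level.\<close>
    have li: "?l m = i - 1"
      using below zero[OF i] zero[of "i - 1" m] i True by force
    show ?thesis
    proof (cases "occupied_of \<Lambda> (Suc m)")
      case occ: True
      then have "\<Lambda> (Suc m) i = 0"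
        using zero[of i "Suc m"] i li by (simp add: occupied_of_def)
      with occ True show ?thesis by (simp add: next_row_def)
    next
      case nocc: False
      \<comment> \<open>Row \<open>i\<close> of level \<open>m + 1\<close> is thus nonzero while row
        \<open>i\<close> of level \<open>m\<close> is zero, so case (3b) applies.\<close>
      then have l': "?l (Suc m) = i"
        using column_length_not_occupied[OF assms(1) nocc] li i by simp
      have ne: "\<Lambda> m i \<noteq> \<Lambda> (Suc m) i"
        using zero[of i "Suc m"] i True l' by simp
      \<comment> \<open>Here \<open>D = m - i\<close>, and level \<open>m + 1\<close> has
        \<open>m + 1 - i = D + 1\<close> empty rows, whence \<open>R = 1 - t\<close>. R leads to a
        row \<open>\<le> i\<close>, which is nonzero, and L to the empty row
        \<open>Suc i\<close>.\<close>
      have "{j \<in> {1..m}. j \<noteq> i \<and> \<Lambda> m j = \<Lambda> m i} = {j \<in> {1..m}. \<Lambda> m j = 0} - {i}"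
        using True by auto
      moreover have "i \<in> {j \<in> {1..m}. \<Lambda> m j = 0}"
        using True i by simp
      ultimately have "card {j \<in> {1..m}. j \<noteq> i \<and> \<Lambda> m j = \<Lambda> m i} = m - i"
        using card_zero_rows[of m \<Lambda>] li i by (simp add: card_Diff_singleton)
      moreover have "card {j \<in> {1..Suc m}. \<Lambda> (Suc m) j = \<Lambda> m i} = Suc m - i"
        using card_zero_rows[of "Suc m" \<Lambda>] l' True by simp
      ultimately have "R_prob t \<Lambda> m i = 1 - t"
        using i by (simp add: R_prob_def Suc_diff_le)
      then show ?thesis
        using ne nocc True zero[of "nearest_neighbor \<Lambda> m i" "Suc m"] zero[of "Suc i" "Suc m"]
          l' nn i by (auto simp: next_row_def)
    qed
  next
    case False
    then have il: "i \<le> ?l m" using zero[OF i] by simp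
    \<comment> \<open>Rows up to \<open>i\<close> of level \<open>m + 1\<close> are nonzero, so (3a)
      and R cannot reach an empty row. It remains to exclude L.\<close>
    have "\<Lambda> (Suc m) (Suc i) \<noteq> 0" if ne: "\<Lambda> m i \<noteq> \<Lambda> (Suc m) i" and "\<not> u (Suc m) < R_prob t \<Lambda> m i"
    proof
      assume "\<Lambda> (Suc m) (Suc i) = 0"
      then have "?l (Suc m) < Suc i" using zero[of "Suc i" "Suc m"] i by simp
      then have l: "?l m = i" "?l (Suc m) = i"
        using column_length_Suc(1)[OF assms(1), of m] il by auto
      \<comment> \<open>Earlier rows are strictly longer because row \<open>i\<close> is movable;
        later rows are empty because the column length is \<open>i\<close>.\<close>
      have "\<Lambda> m j \<noteq> \<Lambda> m i" if "j \<in> {1..m}" "j \<noteq> i" for j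
      proof (cases "j < i")
        case True
        then show ?thesis using mono[of j "i - 1" m] below that i by force
      next
        case False
        then show ?thesis using zero[of j m] that l \<open>\<Lambda> m i \<noteq> 0\<close> by simp
      qed
      then have D: "{j \<in> {1..m}. j \<noteq> i \<and> \<Lambda> m j = \<Lambda> m i} = {}" by auto
      have "\<Lambda> (Suc m) j \<noteq> \<Lambda> m i" if "j \<in> {1..Suc m}" for j
      proof (cases "j \<le> i")
        case True
        then show ?thesis
          using mono[of j i "Suc m"] interlacingD(2)[OF assms(1) i] ne that i by force
      next
        case False
        then show ?thesis using zero[of j "Suc m"] that l \<open>\<Lambda> m i \<noteq> 0\<close> by simp
      qed
      then have E: "{j \<in> {1..Suc m}. \<Lambda> (Suc m) j = \<Lambda> m i} = {}" by blast
      \<comment> \<open>Both counts are 0, so the second formula applies with \<open>D = 0\<close>;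
        \<open>t < 1\<close> makes the quotient 1, and \<open>u (Suc m) < 1\<close> then forces
        R.\<close>
      have "R_prob t \<Lambda> m i = 1"
        unfolding R_prob_def D E using assms(4) by simp
      with that assms(3) show False by simp
    qed
    then show ?thesis
      using False il column_length_Suc(1)[OF assms(1), of m] zero[of i "Suc m"]
        zero[of "nearest_neighbor \<Lambda> m i" "Suc m"] nn i
      by (auto simp: next_row_def)
  qed
qed

text \<open>The coupling: on each level both recursions consult the same variable. Whenever an empty
  row has moved and the next row is vacant, R and turning right are the same event
  \<open>u (Suc m) < 1 - t\<close>.\<close>

lemma moved_row_zero_iff:
  assumes "interlacing \<Lambda>" "1 \<le> k" "\<And>m. u m < 1" "t < 1"
  shows "\<Lambda> (k + d) (moved_row t u \<Lambda> k d) = 0 \<longleftrightarrow> path_leaves_up t u (occupied_of \<Lambda>) k d"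
proof (induction d)
  case 0
  then show ?case
    using first_moved_row_zero_iff[OF assms(1,2), of t u] by simp
next
  case (Suc d)
  then show ?case
    using next_row_zero_iff[OF assms(1) movable_moved_row[OF assms(1,2), of d t u], of u t] assms(3,4)
    by auto
qed

lemma occupied_of_rsk_step:
  assumes "interlacing \<Lambda>" "1 \<le> k" "\<And>m. u m < 1" "t < 1" "1 \<le> y"
  shows "occupied_of (rsk_step t u k \<Lambda>) y \<longleftrightarrow> sixv_step t u k (occupied_of \<Lambda>) y"
proof -
  note len = column_length_rsk_step[OF assms(1,2), of t u]
  note zero = moved_row_zero_iff[OF assms(1,2), of u t, OF assms(3,4)]
  obtain z where y: "y = Suc z" using assms(5) by (cases y) auto
  consider "y < k" | "y = k" | "k \<le> z" using y by linarith
  then show ?thesis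
  proof cases
    case 1
    then show ?thesis by (auto simp: occupied_of_def len sixv_step_def)
  next
    case 2
    \<comment> \<open>Level \<open>k - 1\<close> is unchanged and level \<open>k\<close> gets longer
      iff row \<open>k\<close> was occupied, so row \<open>k\<close> ends up vacant.\<close>
    then show ?thesis
      using zero[of 0] column_length_not_occupied[OF assms(1), of z] y
      by (auto simp: occupied_of_def len sixv_step_def)
  next
    case 3
    then obtain d where d: "z = k + d" using le_Suc_ex by blast
    \<comment> \<open>A path that leaves row \<open>z\<close> but not row \<open>y\<close> lengthens
      level \<open>z\<close> alone. It found row \<open>y\<close> vacant, so the difference of
      column lengths drops from 1 to 0 and row \<open>y\<close> becomes occupied.\<close>
    show ?thesis
      using zero[of d] zero[of "Suc d"] column_length_not_occupied[OF assms(1), of z] y d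
      by (auto simp: occupied_of_def len sixv_step_def)
  qed
qed

section \<open>The pathwise identity\<close>

lemma sixv_step_cong:
  assumes "\<And>y. 1 \<le> y \<Longrightarrow> S y \<longleftrightarrow> S' y" "1 \<le> k" "1 \<le> y"
  shows "sixv_step t u k S y \<longleftrightarrow> sixv_step t u k S' y"
proof -
  have "path_leaves_up t u S k d \<longleftrightarrow> path_leaves_up t u S' k d" for d
    using assms(1,2) by (induction d) auto
  with assms show ?thesis by (simp add: sixv_step_def)
qed

text \<open>The comparison is deterministic: it holds for any list of points at rows
  \<open>k \<ge> 1\<close>, provided all variables used are below 1.\<close>

lemma fold_rsk_step_sixv_step:
  assumes "t < 1"
    and "\<And>p m. p \<in> set L \<Longrightarrow> u p m < 1" "\<And>k j. (k, j) \<in> set L \<Longrightarrow> 1 \<le> k"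
    and "interlacing \<Lambda>" "\<And>y. 1 \<le> y \<Longrightarrow> occupied_of \<Lambda> y \<longleftrightarrow> S y"
  shows "interlacing (fold (\<lambda>(k, j). rsk_step t (u (k, j)) k) L \<Lambda>) \<and>
    (\<forall>y\<ge>1. occupied_of (fold (\<lambda>(k, j). rsk_step t (u (k, j)) k) L \<Lambda>) y \<longleftrightarrow>
      fold (\<lambda>(k, j). sixv_step t (u (k, j)) k) L S y)"
  using assms(2-)
proof (induction L arbitrary: \<Lambda> S)
  case (Cons p L)
  obtain k j where p: "p = (k, j)" by (cases p)
  have k: "1 \<le> k" using Cons.prems(2) p by auto
  have u: "u (k, j) m < 1" for m using Cons.prems(1)[of p m] p by simp
  have i: "interlacing (rsk_step t (u (k, j)) k \<Lambda>)"
    by (rule interlacing_rsk_step[OF Cons.prems(3) k])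
  have o: "occupied_of (rsk_step t (u (k, j)) k \<Lambda>) y \<longleftrightarrow> sixv_step t (u (k, j)) k S y"
    if "1 \<le> y" for y
    using occupied_of_rsk_step[OF Cons.prems(3) k u assms(1) that]
      sixv_step_cong[OF Cons.prems(4) k that] by simp
  show ?case
    unfolding p fold_simps prod.case
  proof (rule Cons.IH)
    show "u q m < 1" if "q \<in> set L" for q m
      using Cons.prems(1) that by simp
    show "1 \<le> k'" if "(k', j') \<in> set L" for k' j'
      using Cons.prems(2)[of k' j'] that by simp
  qed (use i o in auto)
qed auto

text \<open>Each level either contributes an occupied row or lengthens the first column by
  one.\<close>

lemma card_occupied_of:
  assumes "interlacing \<Lambda>"
  shows "card {y' \<in> {1..y}. occupied_of \<Lambda> y'} + column_length \<Lambda> y = y"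
proof (induction y)
  case (Suc y)
  have "{y' \<in> {1..Suc y}. occupied_of \<Lambda> y'} =
      (if occupied_of \<Lambda> (Suc y) then insert (Suc y) else id) {y' \<in> {1..y}. occupied_of \<Lambda> y'}"
    by (auto simp: le_Suc_eq)
  then show ?case
    using Suc column_length_not_occupied[OF assms, of y] by (auto simp: occupied_of_def)
qed simp

lemma set_points_upto: "(k, j) \<in> set (points_upto T n \<tau> \<omega>) \<Longrightarrow> 1 \<le> k"
  by (auto simp: points_upto_def)

lemma sixv_height_eq_rsk_first_column:
  assumes "\<And>k j m. 1 \<le> k \<Longrightarrow> U k j m \<omega> < 1" "t < 1"
  shows "int (sixv_height t T U \<tau> y \<omega>) = int y - int (rsk_first_column t T U \<tau> y \<omega>)"
proof -
  let ?L = "points_upto T y \<tau> \<omega>" and ?u = "\<lambda>(k, j) m. U k j m \<omega>"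
  \<comment> \<open>All column lengths of the zero array vanish, so it encodes the fully occupied
    left boundary.\<close>
  have 0: "interlacing (\<lambda>_ _. 0)" "\<And>y. 1 \<le> y \<Longrightarrow> occupied_of (\<lambda>_ _. 0) y \<longleftrightarrow> True"
    by (auto simp: interlacing_def occupied_of_def column_length_def)
  have u: "\<And>p m. p \<in> set ?L \<Longrightarrow> ?u p m < 1"
    using assms(1) set_points_upto by (force split: prod.splits)
  let ?\<Lambda> = "rsk_array t T U y \<tau> \<omega>"
  have fold: "interlacing ?\<Lambda> \<and>
      (\<forall>y'\<ge>1. occupied_of ?\<Lambda> y' \<longleftrightarrow> sixv_occupied t T U y \<tau> \<omega> y')"
    using fold_rsk_step_sixv_step[OF assms(2), of ?L ?u "\<lambda>_ _. 0" "\<lambda>_. True", OF u set_points_upto 0]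
    by (simp add: rsk_array_def sixv_occupied_def)
  have inter: "interlacing ?\<Lambda>"
    using fold by blast
  have "occupied_of ?\<Lambda> y' \<longleftrightarrow> sixv_occupied t T U y \<tau> \<omega> y'" if "1 \<le> y'" for y'
    using fold that by blast
  then have "{y' \<in> {1..y}. sixv_occupied t T U y \<tau> \<omega> y'} = {y' \<in> {1..y}. occupied_of ?\<Lambda> y'}"
    by auto
  then have "sixv_height t T U \<tau> y \<omega> + rsk_first_column t T U \<tau> y \<omega> = y"
    using card_occupied_of[OF inter, of y]
    by (simp add: sixv_height_def rsk_first_column_def column_length_def)
  then show ?thesis by linarith
qed

section \<open>Measurability of the two models\<close>

lemma measurable_insort_key:
  fixes f :: "'w \<Rightarrow> 'a::countable \<Rightarrow> real"
  assumes [measurable]: "\<And>p q. Measurable.pred M (\<lambda>\<omega>. f \<omega> p \<le> f \<omega> q)"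
  shows "(\<lambda>\<omega>. insort_key (f \<omega>) x L) \<in> M \<rightarrow>\<^sub>M count_space UNIV"
proof (induction L)
  case (Cons y L)
  have "(\<lambda>\<omega>. y # insort_key (f \<omega>) x L) \<in> M \<rightarrow>\<^sub>M count_space UNIV"
    using Cons by (rule measurable_compose) simp
  then show ?case by simp
qed simp

text \<open>Sorting reads the random keys only through comparisons of pairs, and its values lie in a
  countable type.\<close>

lemma measurable_sort_key:
  fixes f :: "'w \<Rightarrow> 'a::countable \<Rightarrow> real"
  assumes "\<And>p q. Measurable.pred M (\<lambda>\<omega>. f \<omega> p \<le> f \<omega> q)"
  shows "(\<lambda>\<omega>. sort_key (f \<omega>) L) \<in> M \<rightarrow>\<^sub>M count_space UNIV"
proof (induction L)
  case (Cons x L)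
  have "(\<lambda>\<omega>. insort_key (f \<omega>) x (sort_key (f \<omega>) L)) \<in> M \<rightarrow>\<^sub>M count_space UNIV"
    by (rule measurable_compose_countable[OF measurable_insort_key[OF assms] Cons])
  then show ?case by simp
qed simp

lemma measurable_points_upto:
  assumes [measurable]: "\<And>k j. T k j \<in> borel_measurable M"
  shows "points_upto T n \<tau> \<in> M \<rightarrow>\<^sub>M count_space UNIV"
proof -
  have unsorted: "(\<lambda>\<omega>. concat (map (\<lambda>k. map (Pair k) [0..<card {j. T k j \<omega> \<le> \<tau>}]) ks))
      \<in> M \<rightarrow>\<^sub>M count_space UNIV" for ks
  proof (induction ks)
    case (Cons k ks)
    \<comment> \<open>This holds everywhere, including where the set is infinite and
      \<open>card\<close> is 0.\<close>
    have "(\<lambda>\<omega>. card {j. T k j \<omega> \<le> \<tau>}) \<in> M \<rightarrow>\<^sub>M count_space UNIV"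
      by measurable
    then have "(\<lambda>\<omega>. map (Pair k) [0..<card {j. T k j \<omega> \<le> \<tau>}]) \<in> M \<rightarrow>\<^sub>M count_space UNIV"
      by (rule measurable_compose) simp
    then have "(\<lambda>\<omega>. map (Pair k) [0..<card {j. T k j \<omega> \<le> \<tau>}] @
        concat (map (\<lambda>k. map (Pair k) [0..<card {j. T k j \<omega> \<le> \<tau>}]) ks)) \<in> M \<rightarrow>\<^sub>M count_space UNIV"
      by (rule measurable_compose_countable[rotated]) (rule measurable_compose[OF Cons], simp)
    then show ?case by simp
  qed simp
  have "Measurable.pred M (\<lambda>\<omega>. (case p of (k, j) \<Rightarrow> T k j \<omega>) \<le> (case q of (k, j) \<Rightarrow> T k j \<omega>))" for p q
    by (cases p; cases q) simp
  then show ?thesis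
    unfolding points_upto_def[abs_def]
    by (rule measurable_compose_countable[OF measurable_sort_key unsorted])
qed

lemma measurable_path_leaves_up:
  assumes [measurable]: "\<And>m. u m \<in> borel_measurable M" "\<And>y. Measurable.pred M (\<lambda>\<omega>. S \<omega> y)"
  shows "Measurable.pred M (\<lambda>\<omega>. path_leaves_up t (\<lambda>m. u m \<omega>) (S \<omega>) k d)"
proof (induction d)
  case (Suc d)
  note [measurable] = Suc
  show ?case by simp
qed simp

lemma measurable_sixv_step:
  assumes [measurable]: "\<And>m. u m \<in> borel_measurable M" "\<And>y. Measurable.pred M (\<lambda>\<omega>. S \<omega> y)"
  shows "Measurable.pred M (\<lambda>\<omega>. sixv_step t (\<lambda>m. u m \<omega>) k (S \<omega>) y)"
proof -
  note [measurable] = measurable_path_leaves_up[OF assms]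
  show ?thesis unfolding sixv_step_def by simp
qed

text \<open>The list is fixed and only the state is random. The random list of points is substituted
  afterwards, its values lying in a countable type.\<close>

lemma measurable_fold_sixv_step:
  assumes "\<And>k j m. U k j m \<in> borel_measurable M" "\<And>y. Measurable.pred M (\<lambda>\<omega>. S \<omega> y)"
  shows "Measurable.pred M (\<lambda>\<omega>. fold (\<lambda>(k, j). sixv_step t (\<lambda>m. U k j m \<omega>) k) L (S \<omega>) y)"
  using assms(2)
proof (induction L arbitrary: S)
  case (Cons p L)
  obtain k j where "p = (k, j)" by (cases p)
  then show ?case
    using Cons.IH[OF measurable_sixv_step[OF assms(1) Cons.prems]] by simp
qed simp

lemma measurable_moved_row:
  assumes [measurable]: "\<And>m. u m \<in> borel_measurable M"
    and \<Lambda> [measurable]: "\<And>m i. (\<lambda>\<omega>. \<Lambda> \<omega> m i) \<in> M \<rightarrow>\<^sub>M count_space UNIV"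
  shows "(\<lambda>\<omega>. moved_row t (\<lambda>m. u m \<omega>) (\<Lambda> \<omega>) k d) \<in> M \<rightarrow>\<^sub>M count_space UNIV"
proof (induction d)
  have eq [measurable]: "Measurable.pred M (\<lambda>\<omega>. \<Lambda> \<omega> m i = \<Lambda> \<omega> m' i')" for m i m' i'
    by (rule measurable_compose_countable[OF _ \<Lambda>, where f = "\<lambda>n \<omega>. n = \<Lambda> \<omega> m' i'"]) simp
  {
    case 0
    show ?case
      unfolding moved_row.simps free_rows_def blocked_def by (rule measurable_Max_nat) simp
  next
    case (Suc d)
    have [measurable]: "(\<lambda>\<omega>. nearest_neighbor (\<Lambda> \<omega>) m i) \<in> M \<rightarrow>\<^sub>M count_space UNIV" for m i
      unfolding nearest_neighbor_def free_rows_def blocked_def mem_Collect_eq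
      by (rule measurable_Max_nat) simp
    \<comment> \<open>R depends on the array only through two counts, which are frozen one after the
      other.\<close>
    have [measurable]: "(\<lambda>\<omega>. R_prob t (\<Lambda> \<omega>) m i) \<in> borel_measurable M" for m i
    proof -
      have D: "(\<lambda>\<omega>. card {j \<in> {1..m}. j \<noteq> i \<and> \<Lambda> \<omega> m j = \<Lambda> \<omega> m i}) \<in> M \<rightarrow>\<^sub>M count_space UNIV"
        by (rule measurable_card) simp
      have E: "(\<lambda>\<omega>. card {j \<in> {1..Suc m}. \<Lambda> \<omega> (Suc m) j = \<Lambda> \<omega> m i}) \<in> M \<rightarrow>\<^sub>M count_space UNIV"
        by (rule measurable_card) simp
      show ?thesis
        unfolding R_prob_def Let_def
        by (rule measurable_compose_countable[OF measurable_compose_countable[OF _ E] D]) simp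
    qed
    have "(\<lambda>\<omega>. next_row t (\<lambda>m. u m \<omega>) (\<Lambda> \<omega>) m i) \<in> M \<rightarrow>\<^sub>M count_space UNIV" for m i
      unfolding next_row_def by (intro measurable_If) simp_all
    from measurable_compose_countable[OF this Suc] show ?case by simp
  }
qed

lemma measurable_rsk_step:
  assumes "\<And>m. u m \<in> borel_measurable M"
    and [measurable]: "\<And>m i. (\<lambda>\<omega>. \<Lambda> \<omega> m i) \<in> M \<rightarrow>\<^sub>M count_space UNIV"
  shows "(\<lambda>\<omega>. rsk_step t (\<lambda>m. u m \<omega>) k (\<Lambda> \<omega>) m i) \<in> M \<rightarrow>\<^sub>M count_space UNIV"
proof -
  note [measurable] = measurable_moved_row[OF assms]
  show ?thesis unfolding rsk_step_def by measurable
qed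

lemma measurable_fold_rsk_step:
  assumes "\<And>k j m. U k j m \<in> borel_measurable M"
    and "\<And>m i. (\<lambda>\<omega>. \<Lambda> \<omega> m i) \<in> M \<rightarrow>\<^sub>M count_space UNIV"
  shows "(\<lambda>\<omega>. fold (\<lambda>(k, j). rsk_step t (\<lambda>m. U k j m \<omega>) k) L (\<Lambda> \<omega>) m i) \<in> M \<rightarrow>\<^sub>M count_space UNIV"
  using assms(2)
proof (induction L arbitrary: \<Lambda>)
  case (Cons p L)
  obtain k j where "p = (k, j)" by (cases p)
  then show ?case
    using Cons.IH[OF measurable_rsk_step[OF assms(1) Cons.prems]] by simp
qed simp

section \<open>Dependence on the noise of rows \<open>k \<ge> 1\<close> only\<close>

lemma insort_key_cong:
  assumes "f x = g x" "\<And>y. y \<in> set L \<Longrightarrow> f y = g y"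
  shows "insort_key f x L = insort_key g x L"
  using assms by (induction L) auto

lemma sort_key_cong:
  assumes "\<And>x. x \<in> set L \<Longrightarrow> f x = g x"
  shows "sort_key f L = sort_key g L"
  using assms
proof (induction L)
  case (Cons x L)
  then show ?case
    using insort_key_cong[of f x g "sort_key g L"] by simp
qed simp

text \<open>The two sample points may live in different spaces, so these congruences serve both to
  alter row 0 and to transport heights to the space of noise sequences.\<close>

context
  fixes T :: "nat \<Rightarrow> nat \<Rightarrow> 'v \<Rightarrow> real" and U :: "nat \<Rightarrow> nat \<Rightarrow> nat \<Rightarrow> 'v \<Rightarrow> real" and \<omega> :: 'v
    and T' :: "nat \<Rightarrow> nat \<Rightarrow> 'w \<Rightarrow> real" and U' :: "nat \<Rightarrow> nat \<Rightarrow> nat \<Rightarrow> 'w \<Rightarrow> real" and \<omega>' :: 'w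
  assumes T: "\<And>k j. 1 \<le> k \<Longrightarrow> T k j \<omega> = T' k j \<omega>'"
    and U: "\<And>k j m. 1 \<le> k \<Longrightarrow> U k j m \<omega> = U' k j m \<omega>'"
begin

lemma points_upto_cong: "points_upto T n \<tau> \<omega> = points_upto T' n \<tau> \<omega>'"
proof -
  have "concat (map (\<lambda>k. map (Pair k) [0..<card {j. T k j \<omega> \<le> \<tau>}]) [1..<Suc n]) =
      concat (map (\<lambda>k. map (Pair k) [0..<card {j. T' k j \<omega>' \<le> \<tau>}]) [1..<Suc n])"
    using T by (intro arg_cong[where f = concat] map_cong) auto
  then show ?thesis
    unfolding points_upto_def using T by (auto intro!: sort_key_cong)
qed

lemma sixv_height_cong: "sixv_height t T U \<tau> y \<omega> = sixv_height t T' U' \<tau> y \<omega>'"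
proof -
  have "sixv_occupied t T U y \<tau> \<omega> = sixv_occupied t T' U' y \<tau> \<omega>'"
    unfolding sixv_occupied_def points_upto_cong
    by (rule fold_cong) (auto simp: U dest!: set_points_upto)
  then show ?thesis by (simp add: sixv_height_def)
qed

lemma rsk_first_column_cong: "rsk_first_column t T U \<tau> y \<omega> = rsk_first_column t T' U' \<tau> y \<omega>'"
proof -
  have "rsk_array t T U y \<tau> \<omega> = rsk_array t T' U' y \<tau> \<omega>'"
    unfolding rsk_array_def points_upto_cong
    by (rule fold_cong) (auto simp: U dest!: set_points_upto)
  then show ?thesis by (simp add: rsk_first_column_def)
qed

end

lemma
  assumes T: "\<And>k j. 1 \<le> k \<Longrightarrow> T k j \<in> borel_measurable M"
    and U: "\<And>k j m. 1 \<le> k \<Longrightarrow> U k j m \<in> borel_measurable M"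
  shows measurable_sixv_height: "sixv_height t T U \<tau> y \<in> M \<rightarrow>\<^sub>M count_space UNIV"
    and measurable_rsk_first_column: "rsk_first_column t T U \<tau> y \<in> M \<rightarrow>\<^sub>M count_space UNIV"
proof -
  \<comment> \<open>Row \<open>0\<close> is never read, but the random variables indexed by it need not be measurable.\<close>
  define T' where "T' k = T (max 1 k)" for k
  define U' where "U' k = U (max 1 k)" for k
  have T': "T' k j \<in> borel_measurable M" and U': "U' k j m \<in> borel_measurable M" for k j m
    using T[of "max 1 k" j] U[of "max 1 k" j m] by (simp_all add: T'_def U'_def)
  note points = measurable_points_upto[of T', OF T']
  have [measurable]: "Measurable.pred M (\<lambda>\<omega>. sixv_occupied t T' U' y \<tau> \<omega> y')" for y'
    unfolding sixv_occupied_def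
    by (rule measurable_compose_countable[OF measurable_fold_sixv_step points]) (auto intro: U')
  have "sixv_height t T' U' \<tau> y \<in> M \<rightarrow>\<^sub>M count_space UNIV"
    unfolding sixv_height_def[abs_def] by measurable
  moreover have "sixv_height t T U \<tau> y = sixv_height t T' U' \<tau> y"
    by (rule ext, rule sixv_height_cong) (auto simp: T'_def U'_def max_def)
  ultimately show "sixv_height t T U \<tau> y \<in> M \<rightarrow>\<^sub>M count_space UNIV" by simp
  have [measurable]: "(\<lambda>\<omega>. rsk_array t T' U' y \<tau> \<omega> m i) \<in> M \<rightarrow>\<^sub>M count_space UNIV" for m i
    unfolding rsk_array_def
    by (rule measurable_compose_countable[OF measurable_fold_rsk_step points]) (auto intro: U')
  have "rsk_first_column t T' U' \<tau> y \<in> M \<rightarrow>\<^sub>M count_space UNIV"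
    unfolding rsk_first_column_def[abs_def] by measurable
  moreover have "rsk_first_column t T U \<tau> y = rsk_first_column t T' U' \<tau> y"
    by (rule ext, rule rsk_first_column_cong) (auto simp: T'_def U'_def max_def)
  ultimately show "rsk_first_column t T U \<tau> y \<in> M \<rightarrow>\<^sub>M count_space UNIV" by simp
qed

section \<open>The noise as a random element of a product space, and its law\<close>

type_synonym noise_index = "(nat \<times> nat) + (nat \<times> nat \<times> nat)"

definition noise_indices :: "noise_index set" where
  "noise_indices = ({1..} \<times> UNIV) <+> ({1..} \<times> UNIV \<times> UNIV)"

lemma noise_indices_iff [simp]:
  "Inl (k, i) \<in> noise_indices \<longleftrightarrow> 1 \<le> k" "Inr (k, j, m) \<in> noise_indices \<longleftrightarrow> 1 \<le> k"
  by (auto simp: noise_indices_def)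

definition noise_law :: "(nat \<Rightarrow> real) \<Rightarrow> noise_index \<Rightarrow> real measure" where
  "noise_law c = case_sum (\<lambda>(k, j). density lborel (exponential_density (c k)))
     (\<lambda>_. uniform_measure lborel {0..1})"

text \<open>The restriction to \<open>noise_indices\<close> makes the value a point of the product
  space, as \<open>PiM\<close> demands.\<close>

definition noise :: "(nat \<Rightarrow> nat \<Rightarrow> 'w \<Rightarrow> real) \<Rightarrow> (nat \<Rightarrow> nat \<Rightarrow> nat \<Rightarrow> 'w \<Rightarrow> real) \<Rightarrow>
    'w \<Rightarrow> noise_index \<Rightarrow> real" where
  "noise T U \<omega> = (\<lambda>i\<in>noise_indices.
     case_sum (\<lambda>(k, j). spacing T k j) (\<lambda>(k, j, m). U k j m) i \<omega>)"

text \<open>Inverse of \<open>spacing\<close>: the points are the partial sums of the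
  spacings.\<close>

definition noise_point :: "nat \<Rightarrow> nat \<Rightarrow> (noise_index \<Rightarrow> real) \<Rightarrow> real" where
  "noise_point k j x = (\<Sum>i\<le>j. x (Inl (k, i)))"

definition noise_uniform :: "nat \<Rightarrow> nat \<Rightarrow> nat \<Rightarrow> (noise_index \<Rightarrow> real) \<Rightarrow> real" where
  "noise_uniform k j m x = x (Inr (k, j, m))"

lemma sum_spacing: "(\<Sum>i\<le>j. spacing T k i \<omega>) = T k j \<omega>"
  by (induction j) (auto simp: spacing_def)

lemma sixv_height_noise:
  "sixv_height t T U \<tau> y \<omega> = sixv_height t noise_point noise_uniform \<tau> y (noise T U \<omega>)"
  by (rule sixv_height_cong)
    (auto simp: noise_point_def noise_uniform_def noise_def sum_spacing)

lemma measurable_sixv_height_noise: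
  "sixv_height t noise_point noise_uniform \<tau> y
    \<in> (\<Pi>\<^sub>M i\<in>noise_indices. borel) \<rightarrow>\<^sub>M count_space UNIV"
proof (rule measurable_sixv_height)
  fix k j m :: nat assume k: "1 \<le> k"
  have "(\<lambda>x. \<Sum>i\<le>j. x (Inl (k, i)) :: real) \<in> borel_measurable (\<Pi>\<^sub>M i\<in>noise_indices. borel)"
    by (rule borel_measurable_sum, rule measurable_component_singleton) (use k in simp)
  then show "noise_point k j \<in> borel_measurable (\<Pi>\<^sub>M i\<in>noise_indices. borel)"
    by (simp add: noise_point_def[abs_def])
  have "(\<lambda>x. x (Inr (k, j, m)) :: real) \<in> borel_measurable (\<Pi>\<^sub>M i\<in>noise_indices. borel)"
    by (rule measurable_component_singleton) (use k in simp)
  then show "noise_uniform k j m \<in> borel_measurable (\<Pi>\<^sub>M i\<in>noise_indices. borel)"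
    by (simp add: noise_uniform_def[abs_def])
qed

context
  fixes M :: "'w measure" and c :: "nat \<Rightarrow> real" and T :: "nat \<Rightarrow> nat \<Rightarrow> 'w \<Rightarrow> real"
    and U :: "nat \<Rightarrow> nat \<Rightarrow> nat \<Rightarrow> 'w \<Rightarrow> real"
  assumes driving: "driving_noise M c T U"
begin

lemma indep_noise:
  "prob_space.indep_vars M (\<lambda>_. borel)
    (case_sum (\<lambda>(k, j). spacing T k j) (\<lambda>(k, j, m). U k j m)) noise_indices"
  using driving by (simp add: driving_noise_def noise_indices_def)

lemma prob_space_noise: "prob_space M"
  using driving by (simp add: driving_noise_def)

lemma measurable_noise_component:
  assumes "i \<in> noise_indices"
  shows "case_sum (\<lambda>(k, j). spacing T k j) (\<lambda>(k, j, m). U k j m) i \<in> borel_measurable M"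
  using indep_noise[unfolded prob_space.indep_vars_def[OF prob_space_noise], THEN conjunct1]
    assms by (rule bspec)

lemma measurable_noise_uniform: "1 \<le> k \<Longrightarrow> U k j m \<in> borel_measurable M"
  using measurable_noise_component[of "Inr (k, j, m)"] by simp

lemma measurable_noise_point:
  assumes "1 \<le> k"
  shows "T k j \<in> borel_measurable M"
proof -
  have "spacing T k i \<in> borel_measurable M" for i
    using measurable_noise_component[of "Inl (k, i)"] assms by simp
  then have "(\<lambda>\<omega>. \<Sum>i\<le>j. spacing T k i \<omega>) \<in> borel_measurable M"
    by (intro borel_measurable_sum)
  then show ?thesis by (simp add: sum_spacing)
qed

lemma measurable_noise: "noise T U \<in> M \<rightarrow>\<^sub>M (\<Pi>\<^sub>M i\<in>noise_indices. borel)"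
  unfolding noise_def[abs_def] by (intro measurable_restrict measurable_noise_component)

text \<open>Independence makes the joint law the product of the marginals, which
  \<open>driving_noise\<close> prescribes.\<close>

lemma distr_noise:
  "distr M (\<Pi>\<^sub>M i\<in>noise_indices. borel) (noise T U) = (\<Pi>\<^sub>M i\<in>noise_indices. noise_law c i)"
proof -
  let ?X = "case_sum (\<lambda>(k, j). spacing T k j) (\<lambda>(k, j, m). U k j m)"
  have "noise_indices \<noteq> {}" by (auto simp: noise_indices_def)
  then have "distr M (\<Pi>\<^sub>M i\<in>noise_indices. borel) (noise T U) =
      (\<Pi>\<^sub>M i\<in>noise_indices. distr M borel (?X i))"
    using prob_space.indep_vars_iff_distr_eq_PiM'[OF prob_space_noise, where M' = "\<lambda>_. borel", of noise_indices ?X]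
      indep_noise measurable_noise_component by (simp add: noise_def[abs_def])
  also have "\<dots> = (\<Pi>\<^sub>M i\<in>noise_indices. noise_law c i)"
  proof (rule PiM_cong)
    fix i assume "i \<in> noise_indices"
    then have "distr M lborel (?X i) = noise_law c i"
      using driving by (auto simp: noise_indices_def noise_law_def driving_noise_def
          distributed_distr_eq_density split: sum.splits)
    \<comment> \<open>The marginals are prescribed over \<open>lborel\<close>, which has the same
      measurable sets as \<open>borel\<close>.\<close>
    moreover have "distr M borel (?X i) = distr M lborel (?X i)"
      by (rule distr_cong) auto
    ultimately show "distr M borel (?X i) = noise_law c i" by simp
  qed simp
  finally show ?thesis .
qed

text \<open>The uniform law lives on the closed interval, so each variable equals 1 only on a null
  set, and there are countably many variables.\<close>

lemma AE_noise_uniform_less_1: "AE \<omega> in M. \<forall>k\<ge>1. \<forall>j m. U k j m \<omega> < 1"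
proof -
  have "AE \<omega> in M. U k j m \<omega> < 1" if k: "1 \<le> k" for k j m
  proof -
    have "AE x in lborel. x \<noteq> (1::real)"
      by (rule AE_lborel_singleton)
    then have "AE x in uniform_measure lborel {0..1::real}. x < 1"
      by (intro AE_uniform_measureI) auto
    moreover have "distr M lborel (U k j m) = uniform_measure lborel {0..1}"
      using driving k unfolding driving_noise_def by blast
    ultimately have "AE x in distr M lborel (U k j m). x < 1" by (simp only:)
    then show ?thesis
      using measurable_noise_uniform[OF k, of j m] by (subst (asm) AE_distr_iff) auto
  qed
  then show ?thesis by (auto simp: AE_all_countable intro!: AE_impI)
qed

text \<open>The right-hand side retains only the intensities, so height fields on different spaces
  with the same intensities have the same law.\<close>

lemma distr_sixv_height:
  "distr M (\<Pi>\<^sub>M p\<in>J. count_space UNIV) (\<lambda>\<omega>. \<lambda>p\<in>J. case p of (\<tau>, y) \<Rightarrow> int (sixv_height t T U \<tau> y \<omega>)) =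
   distr (\<Pi>\<^sub>M i\<in>noise_indices. noise_law c i) (\<Pi>\<^sub>M p\<in>J. count_space UNIV)
     (\<lambda>x. \<lambda>p\<in>J. case p of (\<tau>, y) \<Rightarrow> int (sixv_height t noise_point noise_uniform \<tau> y x))"
proof -
  have "(\<lambda>x. \<lambda>p\<in>J. case p of (\<tau>, y) \<Rightarrow> int (sixv_height t noise_point noise_uniform \<tau> y x))
      \<in> (\<Pi>\<^sub>M i\<in>noise_indices. borel) \<rightarrow>\<^sub>M (\<Pi>\<^sub>M p\<in>J. count_space UNIV)"
  proof (rule measurable_restrict)
    fix p :: "real \<times> nat"
    show "(\<lambda>x. case p of (\<tau>, y) \<Rightarrow> int (sixv_height t noise_point noise_uniform \<tau> y x))
        \<in> (\<Pi>\<^sub>M i\<in>noise_indices. borel) \<rightarrow>\<^sub>M count_space UNIV"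
      by (cases p) (auto intro: measurable_compose[OF measurable_sixv_height_noise])
  qed
  from distr_distr[OF this measurable_noise] show ?thesis
    unfolding distr_noise by (simp add: comp_def sixv_height_noise[of t T U])
qed

end

theorem theorem6p4:
  fixes t :: real and b c :: "nat \<Rightarrow> real"
    and M :: "'v measure"
    and T :: "nat \<Rightarrow> nat \<Rightarrow> 'v \<Rightarrow> real" and U :: "nat \<Rightarrow> nat \<Rightarrow> nat \<Rightarrow> 'v \<Rightarrow> real"
    and N :: "'w measure"
    and T' :: "nat \<Rightarrow> nat \<Rightarrow> 'w \<Rightarrow> real" and U' :: "nat \<Rightarrow> nat \<Rightarrow> nat \<Rightarrow> 'w \<Rightarrow> real"
  assumes "0 < t" and "t < 1"
    and "\<And>i. i \<ge> 1 \<Longrightarrow> b i = c i" and "\<And>i. i \<ge> 1 \<Longrightarrow> c i > 0"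
    and "driving_noise M b T U"
    and "driving_noise N c T' U'"
  shows "identically_distributed_fields ({0..} \<times> {1..})
           M (\<lambda>(\<tau>, y) \<omega>. int (sixv_height t T U \<tau> y \<omega>))
           N (\<lambda>(\<tau>, y) \<omega>. int y - int (rsk_first_column t T' U' \<tau> y \<omega>))"
proof -
  let ?h = "\<lambda>(\<tau>, y) \<omega>. int (sixv_height t T U \<tau> y \<omega>)"
  \<comment> \<open>The intermediate field: the vertex model driven by the noise of the RSK
    dynamics. It has the law of \<open>?h\<close> and is almost surely equal to
    \<open>?l\<close>.\<close>
  let ?h' = "\<lambda>(\<tau>, y) \<omega>. int (sixv_height t T' U' \<tau> y \<omega>)"
  let ?l = "\<lambda>(\<tau>, y) \<omega>. int y - int (rsk_first_column t T' U' \<tau> y \<omega>)"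
  note M = measurable_noise_point[OF assms(5)] measurable_noise_uniform[OF assms(5)]
  note N = measurable_noise_point[OF assms(6)] measurable_noise_uniform[OF assms(6)]
  have h: "?h p \<in> M \<rightarrow>\<^sub>M count_space UNIV" for p
    by (cases p) (auto intro!: measurable_compose[OF measurable_sixv_height] M)
  have h': "?h' p \<in> N \<rightarrow>\<^sub>M count_space UNIV" for p
    by (cases p) (auto intro!: measurable_compose[OF measurable_sixv_height] N)
  have l: "?l p \<in> N \<rightarrow>\<^sub>M count_space UNIV" for p
    by (cases p) (auto intro!: measurable_compose[OF measurable_rsk_first_column] N)
  have "distr M (\<Pi>\<^sub>M p\<in>J. count_space UNIV) (\<lambda>\<omega>. \<lambda>p\<in>J. ?h p \<omega>) =
      distr N (\<Pi>\<^sub>M p\<in>J. count_space UNIV) (\<lambda>\<omega>. \<lambda>p\<in>J. ?l p \<omega>)" for J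
  proof -
    \<comment> \<open>Noise indices have \<open>k \<ge> 1\<close>, where \<open>b\<close> and
      \<open>c\<close> agree.\<close>
    have laws: "(\<Pi>\<^sub>M i\<in>noise_indices. noise_law b i) = (\<Pi>\<^sub>M i\<in>noise_indices. noise_law c i)"
      by (rule PiM_cong) (auto simp: noise_law_def noise_indices_def assms(3))
    have "distr M (\<Pi>\<^sub>M p\<in>J. count_space UNIV) (\<lambda>\<omega>. \<lambda>p\<in>J. ?h p \<omega>) =
        distr N (\<Pi>\<^sub>M p\<in>J. count_space UNIV) (\<lambda>\<omega>. \<lambda>p\<in>J. ?h' p \<omega>)"
      using distr_sixv_height[OF assms(5), of J t] distr_sixv_height[OF assms(6), of J t]
      by (simp add: laws case_prod_app)
    also have "\<dots> = distr N (\<Pi>\<^sub>M p\<in>J. count_space UNIV) (\<lambda>\<omega>. \<lambda>p\<in>J. ?l p \<omega>)"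
    proof (rule distr_cong_AE)
      show "AE \<omega> in N. (\<lambda>p\<in>J. ?h' p \<omega>) = (\<lambda>p\<in>J. ?l p \<omega>)"
        using AE_noise_uniform_less_1[OF assms(6)]
      proof eventually_elim
        case (elim \<omega>)
        then show ?case
          using sixv_height_eq_rsk_first_column[of U' \<omega> t T'] assms(2) by (auto simp: fun_eq_iff)
      qed
    qed (rule refl | rule measurable_restrict, rule h' l)+
    finally show ?thesis .
  qed
  with h l show ?thesis
    unfolding identically_distributed_fields_def by blast
qed

end
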